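(* Consider the joint power and channel allocation problem $$\min_{\{p_j^{(k)}\},\{\bm{O}_j\}}\ \sum_{j=1}^J\frac{1}{K_j}\sum_{k=1}^{K_j} f_j^{(k)}\big(\gamma_j^{(k)}\big)$$ subject to $p_j^{(k)}\ge 0$ for all $j,k$, $\sum_{j=1}^{J}\sum_{k=1}^{K_j}p_j^{(k)}\le P$, $\bm{O}_j(k,k')\in\{0,1\}$ for all $j,k,k'$, and $\sum_{k=1}^{K_j}\bm{O}_j(k,k')=1$, $\sum_{k'=1}^{K_j}\bm{O}_j(k,k')=1$ for all $j,k,k'$, where the received SNR of subimage $k'$ of user $j$ is $$\gamma_j^{(k')}=\frac{p_j^{(k')}}{\sigma^2}\sum_{k=1}^{K_j}\bm{O}_j(k,k')\,\big(\sigma_j^{(k)}\big)^2 ,$$ and the channel gains are ordered as $\sigma_j^{(1)}\ge\sigma_j^{(2)}\ge\cdots\ge\sigma_j^{(K_j)}$ for every $j$. Then it is optimal to allocate the channels with higher gain to the subimages with higher semantic importance: the channel allocation $$\bm{O}_j^*(k_1,k_2)=\begin{cases}1,& k_1=\mathcal{I}_j(k_2),\\ 0,&\text{otherwise},\end{cases}\qquad j=1,\dots,J,$$ is an optimal channel allocation, i.e. there is a feasible power allocation $\{p_j^{(k)*}\}$ such that $(\{p_j^{(k)*}\},\{\bm{O}_j^*\})$ attains the minimum of the problem. Here $\mathcal{I}_j(k)$ is the ranking position (position $1$ being the most important) of the average semantic importance of subimage $k$ among the $K_j$ subimages of user $j$.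
   Context: There are $J$ users; user $j$ receives $K_j\ge 1$ subimages, each over one of $K_j$ parallel interference-free scalar channels with gains $\sigma_j^{(1)},\dots,\sigma_j^{(K_j)}>0$ and common noise power $\sigma^2>0$. $P>0$ is the total power budget, $p_j^{(k)}$ is the power allocated to subimage $k$ of user $j$, and $\bm{O}_j$ is a $K_j\times K_j$ matrix with $\bm{O}_j(k,k')=1$ if channel $k$ carries subimage $k'$ and $0$ otherwise. The reconstruction loss of subimage $k$ of user $j$ as a function of its received SNR $\gamma\ge 0$ is $$f_j^{(k)}(\gamma)=\frac{b_j^{(k)}}{c_j^{(k)}+\gamma^{e_j^{(k)}}}+d_j^{(k)},$$ with positive constants $b_j^{(k)},c_j^{(k)},d_j^{(k)},e_j^{(k)}$; in particular it is decreasing in $\gamma$. For each user $j$, $\mathcal{I}_j$ is a permutation of $\{1,\dots,K_j\}$ ranking the subimages by decreasing semantic importance. Standing modelling assumption (more important subimages have a greater influence on the reconstruction loss): if subimage $k_1$ is more important than subimage $k_2$ of the same user $j$, i.e. $\mathcal{I}_j(k_1)<\mathcal{I}_j(k_2)$, then for all $0\le\gamma<\gamma'$, $$f_j^{(k_1)}(\gamma)-f_j^{(k_1)}(\gamma')>f_j^{(k_2)}(\gamma)-f_j^{(k_2)}(\gamma').$$ *)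

theory Defs
  imports Complex_Main
begin

text \<open>
  Users are indexed by \<open>{1..J}\<close>; subimages and channels of user \<open>j\<close> by \<open>{1..K j}\<close>.
  Families are total functions, and only their values at these indices matter.
\<close>

definition recon_loss ::
  "(nat \<Rightarrow> nat \<Rightarrow> real) \<Rightarrow> (nat \<Rightarrow> nat \<Rightarrow> real) \<Rightarrow> (nat \<Rightarrow> nat \<Rightarrow> real) \<Rightarrow> (nat \<Rightarrow> nat \<Rightarrow> real)
    \<Rightarrow> nat \<Rightarrow> nat \<Rightarrow> real \<Rightarrow> real"
  where "recon_loss b c d e j k \<gamma> = b j k / (c j k + \<gamma> powr e j k) + d j k"

text \<open>\<open>\<sigma> j k\<close> is the gain of channel \<open>k\<close> of user \<open>j\<close>, \<open>\<sigma>n\<^sup>2\<close> the noise power, and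
  \<open>A j k k' = 1\<close> means that channel \<open>k\<close> of user \<open>j\<close> carries subimage \<open>k'\<close>.\<close>

definition received_snr ::
  "(nat \<Rightarrow> nat) \<Rightarrow> (nat \<Rightarrow> nat \<Rightarrow> real) \<Rightarrow> real
    \<Rightarrow> (nat \<Rightarrow> nat \<Rightarrow> real) \<Rightarrow> (nat \<Rightarrow> nat \<Rightarrow> nat \<Rightarrow> real) \<Rightarrow> nat \<Rightarrow> nat \<Rightarrow> real"
  where "received_snr K \<sigma> \<sigma>n p A j k' =
    p j k' / \<sigma>n\<^sup>2 * (\<Sum>k=1..K j. A j k k' * (\<sigma> j k)\<^sup>2)"

definition total_loss ::
  "nat \<Rightarrow> (nat \<Rightarrow> nat) \<Rightarrow> (nat \<Rightarrow> nat \<Rightarrow> real) \<Rightarrow> real \<Rightarrow> (nat \<Rightarrow> nat \<Rightarrow> real \<Rightarrow> real)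
    \<Rightarrow> (nat \<Rightarrow> nat \<Rightarrow> real) \<times> (nat \<Rightarrow> nat \<Rightarrow> nat \<Rightarrow> real) \<Rightarrow> real"
  where "total_loss J K \<sigma> \<sigma>n f = (\<lambda>(p, A).
    \<Sum>j=1..J. 1 / real (K j) * (\<Sum>k=1..K j. f j k (received_snr K \<sigma> \<sigma>n p A j k)))"

definition feasible ::
  "nat \<Rightarrow> (nat \<Rightarrow> nat) \<Rightarrow> real
    \<Rightarrow> (nat \<Rightarrow> nat \<Rightarrow> real) \<times> (nat \<Rightarrow> nat \<Rightarrow> nat \<Rightarrow> real) \<Rightarrow> bool"
  where "feasible J K P = (\<lambda>(p, A).
    (\<forall>j\<in>{1..J}. \<forall>k\<in>{1..K j}. p j k \<ge> 0) \<and>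
    (\<Sum>j=1..J. \<Sum>k=1..K j. p j k) \<le> P \<and>
    (\<forall>j\<in>{1..J}. \<forall>k\<in>{1..K j}. \<forall>k'\<in>{1..K j}. A j k k' \<in> {0, 1}) \<and>
    (\<forall>j\<in>{1..J}. \<forall>k'\<in>{1..K j}. (\<Sum>k=1..K j. A j k k') = 1) \<and>
    (\<forall>j\<in>{1..J}. \<forall>k\<in>{1..K j}. (\<Sum>k'=1..K j. A j k k') = 1))"

definition rank_allocation :: "(nat \<Rightarrow> nat \<Rightarrow> nat) \<Rightarrow> nat \<Rightarrow> nat \<Rightarrow> nat \<Rightarrow> real"
  where "rank_allocation I j k\<^sub>1 k\<^sub>2 = (if k\<^sub>1 = I j k\<^sub>2 then 1 else 0)"

end

theory Submission
  imports Defs "HOL-Analysis.Function_Topology" "HOL-Combinatorics.Transposition"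
begin

text \<open>
  Fix a feasible pair and one user. If the channel of lowest gain does not carry the least
  important subimage \<open>l\<close> but another one \<open>m\<close>, exchange the two channels: when the SNR of \<open>m\<close> is
  the larger one, keep both SNRs, which by rearrangement costs no more power; otherwise exchange
  the SNRs too, which leaves the powers untouched and does not increase the loss by the importance
  assumption. Descending over the ranks, the allocation by rank performs at least as well as any
  other. For this fixed allocation the loss is continuous in the powers on a compact set, so a
  minimum exists.
\<close>

section \<open>Exchange argument for assigning channels to importance ranks\<close>

lemma sum_two_split:
  fixes g :: "nat \<Rightarrow> real"
  assumes "m \<in> {1..n}"
  shows "sum g {1..Suc n} = g m + g (Suc n) + sum g ({1..n} - {m})"
  using assms sum.remove[of "{1..n}" m g] by simp

text \<open>Here \<open>i\<close> is a rank, \<open>\<omega> i\<close> the channel used by the subimage of rank \<open>i\<close>, \<open>\<gamma> i\<close> its SNR and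
  \<open>h k\<close> the power per unit of SNR on channel \<open>k\<close>.\<close>

lemma sorted_assignment_dominates:
  fixes F :: "nat \<Rightarrow> real \<Rightarrow> real" and h \<gamma> :: "nat \<Rightarrow> real"
  assumes "bij_betw \<omega> {1..n} {1..n}"
    and "\<And>i. i \<in> {1..n} \<Longrightarrow> 0 \<le> \<gamma> i"
    and "\<And>i j. i \<in> {1..n} \<Longrightarrow> j \<in> {1..n} \<Longrightarrow> i \<le> j \<Longrightarrow> h i \<le> h j"
    and "\<And>i j x y. i \<in> {1..n} \<Longrightarrow> j \<in> {1..n} \<Longrightarrow> i < j \<Longrightarrow> 0 \<le> x \<Longrightarrow> x < y
           \<Longrightarrow> F i y + F j x \<le> F i x + F j y"
  shows "\<exists>\<delta>. (\<forall>i\<in>{1..n}. 0 \<le> \<delta> i) \<and>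
    (\<Sum>i=1..n. F i (\<delta> i)) \<le> (\<Sum>i=1..n. F i (\<gamma> i)) \<and>
    (\<Sum>i=1..n. \<delta> i * h i) \<le> (\<Sum>i=1..n. \<gamma> i * h (\<omega> i))"
  using assms
proof (induction n arbitrary: \<omega> \<gamma>)
  case 0
  then show ?case by simp
next
  case (Suc n)
  let ?l = "Suc n"
  have "?l \<in> \<omega> ` {1..?l}"
    using Suc.prems(1) by (simp add: bij_betw_def)
  then obtain m where m: "m \<in> {1..?l}" "\<omega> m = ?l"
    by auto
  \<comment> \<open>Composing with the swap \<open>\<tau>\<close> gives the least important rank the
    channel of largest \<open>h\<close>. As \<open>\<omega>'\<close> fixes \<open>?l\<close>, it
    restricts to a bijection of \<open>{1..n}\<close>, which the induction hypothesis can
    take.\<close>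
  define \<tau> where "\<tau> = transpose m ?l"
  define \<omega>' where "\<omega>' = \<omega> \<circ> \<tau>"
  have bt: "bij_betw \<tau> {1..?l} {1..?l}"
    unfolding \<tau>_def using m by simp
  then have b': "bij_betw \<omega>' {1..?l} {1..?l}"
    unfolding \<omega>'_def using Suc.prems(1) by (rule bij_betw_trans)
  have l': "\<omega>' ?l = ?l"
    using m by (simp add: \<omega>'_def \<tau>_def)
  have "bij_betw \<omega>' ({1..?l} - {?l}) ({1..?l} - {?l})"
    using b' by (rule bij_betw_DiffI) (simp_all add: bij_betw_def l')
  then have bn: "bij_betw \<omega>' {1..n} {1..n}"
    by (simp add: atLeastAtMostSuc_conv)
  \<comment> \<open>One exchange: passing from \<open>\<omega>\<close> to \<open>\<omega>'\<close>
    raises neither loss nor power for a suitable choice of SNRs.\<close>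
  have "\<exists>\<delta>. (\<forall>i\<in>{1..?l}. 0 \<le> \<delta> i) \<and>
    (\<Sum>i=1..?l. F i (\<delta> i)) \<le> (\<Sum>i=1..?l. F i (\<gamma> i)) \<and>
    (\<Sum>i=1..?l. \<delta> i * h (\<omega>' i)) \<le> (\<Sum>i=1..?l. \<gamma> i * h (\<omega> i))"
  proof (cases "m = ?l")
    case True
    then show ?thesis
      using Suc.prems(2) by (intro exI[of _ \<gamma>]) (simp add: \<omega>'_def \<tau>_def)
  next
    case False
    then have mn: "m \<in> {1..n}"
      using m by auto
    have \<tau>_simps: "\<tau> m = ?l" "\<tau> ?l = m" "\<And>i. i \<in> {1..n} - {m} \<Longrightarrow> \<tau> i = i"
      by (auto simp: \<tau>_def transpose_def)
    show ?thesis
    proof (cases "\<gamma> ?l \<le> \<gamma> m")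
      case True
      have "\<omega> ?l \<in> {1..?l}"
        using Suc.prems(1) by (auto simp: bij_betw_def)
      then have "h (\<omega> ?l) \<le> h ?l"
        using Suc.prems(3)[of "\<omega> ?l" ?l] by auto
      \<comment> \<open>This product is exactly the power saved when the SNRs are kept and the
        channels exchanged: the larger SNR leaves the most costly channel.\<close>
      then have "0 \<le> (\<gamma> m - \<gamma> ?l) * (h ?l - h (\<omega> ?l))"
        using True by simp
      moreover have "(\<Sum>i\<in>{1..n} - {m}. \<gamma> i * h (\<omega>' i)) = (\<Sum>i\<in>{1..n} - {m}. \<gamma> i * h (\<omega> i))"
        by (intro sum.cong) (simp_all add: \<omega>'_def \<tau>_simps)
      ultimately have "(\<Sum>i=1..?l. \<gamma> i * h (\<omega>' i)) \<le> (\<Sum>i=1..?l. \<gamma> i * h (\<omega> i))"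
        unfolding sum_two_split[OF mn] by (simp add: \<omega>'_def \<tau>_simps m(2) algebra_simps)
      then show ?thesis
        using Suc.prems(2) by blast
    next
      case False
      \<comment> \<open>Now \<open>\<gamma> m < \<gamma> ?l\<close>, so the SNRs travel with the
        channels and the more important \<open>m\<close> receives the larger one. The power sum is
        merely reindexed along \<open>\<tau>\<close>.\<close>
      have "F m (\<gamma> ?l) + F ?l (\<gamma> m) \<le> F m (\<gamma> m) + F ?l (\<gamma> ?l)"
        using Suc.prems(4)[of m ?l "\<gamma> m" "\<gamma> ?l"] Suc.prems(2)[of m] mn False by auto
      moreover have "(\<Sum>i\<in>{1..n} - {m}. F i (\<gamma> (\<tau> i))) = (\<Sum>i\<in>{1..n} - {m}. F i (\<gamma> i))"
        by (intro sum.cong) (simp_all add: \<tau>_simps)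
      ultimately have "(\<Sum>i=1..?l. F i (\<gamma> (\<tau> i))) \<le> (\<Sum>i=1..?l. F i (\<gamma> i))"
        unfolding sum_two_split[OF mn] by (simp add: \<tau>_simps)
      moreover have "(\<Sum>i=1..?l. \<gamma> (\<tau> i) * h (\<omega>' i)) = (\<Sum>i=1..?l. \<gamma> i * h (\<omega> i))"
        using sum.reindex_bij_betw[OF bt, of "\<lambda>i. \<gamma> i * h (\<omega> i)"] by (simp add: \<omega>'_def)
      moreover have "\<forall>i\<in>{1..?l}. 0 \<le> \<gamma> (\<tau> i)"
        using Suc.prems(2) bij_betwE[OF bt] by blast
      ultimately show ?thesis
        by (intro exI[of _ "\<gamma> \<circ> \<tau>"]) simp
    qed
  qed
  then obtain \<delta> where \<delta>: "\<And>i. i \<in> {1..?l} \<Longrightarrow> 0 \<le> \<delta> i"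
      "(\<Sum>i=1..?l. F i (\<delta> i)) \<le> (\<Sum>i=1..?l. F i (\<gamma> i))"
      "(\<Sum>i=1..?l. \<delta> i * h (\<omega>' i)) \<le> (\<Sum>i=1..?l. \<gamma> i * h (\<omega> i))"
    by blast
  have "\<exists>\<epsilon>. (\<forall>i\<in>{1..n}. 0 \<le> \<epsilon> i) \<and>
    (\<Sum>i=1..n. F i (\<epsilon> i)) \<le> (\<Sum>i=1..n. F i (\<delta> i)) \<and>
    (\<Sum>i=1..n. \<epsilon> i * h i) \<le> (\<Sum>i=1..n. \<delta> i * h (\<omega>' i))"
    using Suc.prems(3,4) \<delta>(1) by (intro Suc.IH[OF bn]) auto
  then obtain \<epsilon> where \<epsilon>: "\<forall>i\<in>{1..n}. 0 \<le> \<epsilon> i"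
      "(\<Sum>i=1..n. F i (\<epsilon> i)) \<le> (\<Sum>i=1..n. F i (\<delta> i))"
      "(\<Sum>i=1..n. \<epsilon> i * h i) \<le> (\<Sum>i=1..n. \<delta> i * h (\<omega>' i))"
    by blast
  \<comment> \<open>Rank \<open>?l\<close> keeps its SNR \<open>\<delta> ?l\<close>; because
    \<open>\<omega>' ?l = ?l\<close>, its power term already has the sorted form.\<close>
  define \<epsilon>' where "\<epsilon>' = \<epsilon>(?l := \<delta> ?l)"
  have "(\<Sum>i=1..n. F i (\<epsilon>' i)) = (\<Sum>i=1..n. F i (\<epsilon> i))"
       "(\<Sum>i=1..n. \<epsilon>' i * h i) = (\<Sum>i=1..n. \<epsilon> i * h i)"
    by (auto simp: \<epsilon>'_def intro!: sum.cong)
  moreover have "\<forall>i\<in>{1..?l}. 0 \<le> \<epsilon>' i"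
    using \<epsilon>(1) \<delta>(1)[of ?l] by (auto simp: \<epsilon>'_def)
  ultimately show ?case
    using \<epsilon> \<delta> l' by (intro exI[of _ \<epsilon>']) (auto simp: \<epsilon>'_def)
qed

section \<open>Channel allocations as permutations\<close>

text \<open>The column sums select one channel for each subimage, which defines
  \<open>\<pi>\<close>. The row sums make \<open>\<pi>\<close> injective, and an injective self-map
  of a finite set is onto.\<close>

lemma permutation_matrix_obtains:
  fixes A :: "nat \<Rightarrow> nat \<Rightarrow> real"
  assumes ran: "\<forall>k\<in>{1..n}. \<forall>k'\<in>{1..n}. A k k' \<in> {0, 1}"
    and col: "\<forall>k'\<in>{1..n}. (\<Sum>k=1..n. A k k') = 1"
    and row: "\<forall>k\<in>{1..n}. (\<Sum>k'=1..n. A k k') = 1"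
  obtains \<pi> where "bij_betw \<pi> {1..n} {1..n}"
    and "\<And>k k'. k \<in> {1..n} \<Longrightarrow> k' \<in> {1..n} \<Longrightarrow> A k k' = (if k = \<pi> k' then 1 else 0)"
proof -
  have one: "\<exists>k\<in>S. g k = 1" and uniq: "\<And>k k'. k \<in> S \<Longrightarrow> k' \<in> S \<Longrightarrow> g k = 1 \<Longrightarrow> g k' = 1 \<Longrightarrow> k = k'"
    if "finite S" "\<forall>k\<in>S. g k \<in> {0, 1}" "sum g S = 1" for S and g :: "nat \<Rightarrow> real"
  proof -
    show "\<exists>k\<in>S. g k = 1"
    proof (rule ccontr)
      assume "\<not> (\<exists>k\<in>S. g k = 1)"
      then have "\<forall>k\<in>S. g k = 0"
        using that(2) by auto
      then show False
        using that(3) by simp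
    qed
    fix k k' assume k: "k \<in> S" "k' \<in> S" "g k = 1" "g k' = 1"
    \<comment> \<open>Two distinct ones would already contribute 2 to a sum of nonnegative terms
      that equals 1.\<close>
    have "sum g {k, k'} \<le> sum g S"
      using that k by (intro sum_mono2) auto
    then show "k = k'"
      using k that(3) by (cases "k = k'") auto
  qed
  have "\<forall>k'\<in>{1..n}. \<exists>k\<in>{1..n}. A k k' = 1"
    using ran col by (intro ballI one) auto
  then obtain \<pi> where \<pi>: "\<And>k'. k' \<in> {1..n} \<Longrightarrow> \<pi> k' \<in> {1..n} \<and> A (\<pi> k') k' = 1"
    by metis
  show thesis
  proof
    have "inj_on \<pi> {1..n}"
    proof (rule inj_onI)
      fix k k' assume k: "k \<in> {1..n}" "k' \<in> {1..n}" "\<pi> k = \<pi> k'"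
      show "k = k'"
        using k \<pi>[of k] \<pi>[of k'] ran row by (intro uniq[of "{1..n}" "A (\<pi> k)"]) auto
    qed
    moreover from this have "\<pi> ` {1..n} = {1..n}"
      using \<pi> by (intro endo_inj_surj) auto
    ultimately show "bij_betw \<pi> {1..n} {1..n}"
      by (simp add: bij_betw_def)
    fix k k' assume k: "k \<in> {1..n}" "k' \<in> {1..n}"
    have "A k k' = 0 \<or> A k k' = 1"
      using ran k by auto
    moreover have "k = \<pi> k'" if "A k k' = 1"
      using that k \<pi>[of k'] ran col by (intro uniq[of "{1..n}" "\<lambda>k. A k k'"]) auto
    ultimately show "A k k' = (if k = \<pi> k' then 1 else 0)"
      using \<pi>[OF k(2)] by metis
  qed
qed

lemma received_snr_of_map:
  assumes "\<pi> k' \<in> {1..K j}" and "\<And>k. k \<in> {1..K j} \<Longrightarrow> A j k k' = (if k = \<pi> k' then 1 else 0)"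
  shows "received_snr K \<sigma> \<sigma>n p A j k' = p j k' / \<sigma>n\<^sup>2 * (\<sigma> j (\<pi> k'))\<^sup>2"
proof -
  have "(\<Sum>k=1..K j. A j k k' * (\<sigma> j k)\<^sup>2) = (\<Sum>k=1..K j. if k = \<pi> k' then (\<sigma> j k)\<^sup>2 else 0)"
    using assms(2) by (intro sum.cong) auto
  also have "\<dots> = (\<sigma> j (\<pi> k'))\<^sup>2"
    using assms(1) by (simp add: sum.delta)
  finally show ?thesis
    by (simp add: received_snr_def)
qed

lemma received_snr_rank_allocation:
  assumes "I j k \<in> {1..K j}"
  shows "received_snr K \<sigma> \<sigma>n p (rank_allocation I) j k = p j k / \<sigma>n\<^sup>2 * (\<sigma> j (I j k))\<^sup>2"
  using assms by (intro received_snr_of_map) (auto simp: rank_allocation_def)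

lemma feasible_rank_allocation:
  assumes "\<And>j. j \<in> {1..J} \<Longrightarrow> bij_betw (I j) {1..K j} {1..K j}"
    and "\<And>j k. j \<in> {1..J} \<Longrightarrow> k \<in> {1..K j} \<Longrightarrow> 0 \<le> p j k"
    and "(\<Sum>j=1..J. \<Sum>k=1..K j. p j k) \<le> P"
  shows "feasible J K P (p, rank_allocation I)"
proof -
  have "(\<Sum>k=1..K j. rank_allocation I j k k') = 1" if "j \<in> {1..J}" "k' \<in> {1..K j}" for j k'
    using bij_betwE[OF assms(1)[OF that(1)]] that(2)
    by (simp add: rank_allocation_def sum.delta)
  moreover have "(\<Sum>k'=1..K j. rank_allocation I j k k') = 1" if "j \<in> {1..J}" "k \<in> {1..K j}" for j k
    \<comment> \<open>Reindexing along the bijection \<open>I j\<close> turns the row sum into the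
      sum of the indicator of \<open>k\<close>.\<close>
    using sum.reindex_bij_betw[OF assms(1)[OF that(1)], of "\<lambda>i. if k = i then 1 else (0::real)"] that(2)
    by (simp add: rank_allocation_def sum.delta)
  ultimately show ?thesis
    using assms(2,3) by (auto simp: feasible_def rank_allocation_def)
qed

section \<open>Comparison of allocations for a single user\<close>

text \<open>With the SNRs as variables, the loss no longer sees the allocation, which affects only
  the power they cost. Renaming subimages by rank turns the allocation \<open>R\<close> into the
  identity, so the exchange argument applies. The user's own power does not grow, so users can be
  treated separately despite the shared budget.\<close>

lemma user_power_exchange:
  fixes f :: "nat \<Rightarrow> real \<Rightarrow> real" and s q :: "nat \<Rightarrow> real" and N :: real
  assumes N: "0 < N"
    and s: "\<And>k. k \<in> {1..n} \<Longrightarrow> 0 < s k"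
    and anti: "\<And>k k'. k \<in> {1..n} \<Longrightarrow> k' \<in> {1..n} \<Longrightarrow> k \<le> k' \<Longrightarrow> s k' \<le> s k"
    and R: "bij_betw R {1..n} {1..n}" and \<pi>: "bij_betw \<pi> {1..n} {1..n}"
    and q: "\<And>k. k \<in> {1..n} \<Longrightarrow> 0 \<le> q k"
    and imp: "\<And>k k' x y. k \<in> {1..n} \<Longrightarrow> k' \<in> {1..n} \<Longrightarrow> R k < R k' \<Longrightarrow> 0 \<le> x \<Longrightarrow> x < y
           \<Longrightarrow> f k y + f k' x \<le> f k x + f k' y"
  shows "\<exists>p. (\<forall>k\<in>{1..n}. 0 \<le> p k) \<and> (\<Sum>k=1..n. p k) \<le> (\<Sum>k=1..n. q k) \<and>
    (\<Sum>k=1..n. f k (p k / N * (s (R k))\<^sup>2)) \<le> (\<Sum>k=1..n. f k (q k / N * (s (\<pi> k))\<^sup>2))"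
proof -
  \<comment> \<open>\<open>T i\<close> is the subimage of rank \<open>i\<close>, and
    \<open>\<pi> \<circ> T\<close> sends a rank to the channel that serves it.\<close>
  define T where "T = inv_into {1..n} R"
  have T: "bij_betw T {1..n} {1..n}"
    unfolding T_def using R by (rule bij_betw_inv_into)
  have Tin: "T i \<in> {1..n}" and RT: "R (T i) = i" if "i \<in> {1..n}" for i
    using that bij_betwE[OF T] bij_betw_inv_into_right[OF R] by (auto simp: T_def)
  have TR: "T (R k) = k" and Rin: "R k \<in> {1..n}" and \<pi>in: "\<pi> k \<in> {1..n}" if "k \<in> {1..n}" for k
    using that bij_betwE[OF R] bij_betwE[OF \<pi>] bij_betw_inv_into_left[OF R] by (auto simp: T_def)
  \<comment> \<open>The power that buys one unit of SNR on channel \<open>k\<close>; it is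
    nondecreasing in \<open>k\<close> because the gains are nonincreasing.\<close>
  define h where "h k = N / (s k)\<^sup>2" for k
  define \<gamma> where "\<gamma> k = q k / N * (s (\<pi> k))\<^sup>2" for k
  have "bij_betw (\<pi> \<circ> T) {1..n} {1..n}"
    using T \<pi> by (rule bij_betw_trans)
  moreover have "0 \<le> \<gamma> (T i)" if "i \<in> {1..n}" for i
    using q[OF Tin[OF that]] N by (simp add: \<gamma>_def)
  moreover have "h i \<le> h j" if "i \<in> {1..n}" "j \<in> {1..n}" "i \<le> j" for i j
    unfolding h_def using that N s[of i] s[of j] anti[of i j]
    by (intro divide_left_mono power_mono) auto
  moreover have "f (T i) y + f (T j) x \<le> f (T i) x + f (T j) y"
    if "i \<in> {1..n}" "j \<in> {1..n}" "i < j" "0 \<le> x" "x < y" for i j x y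
    by (intro imp Tin) (use that RT in auto)
  ultimately have "\<exists>\<delta>. (\<forall>i\<in>{1..n}. 0 \<le> \<delta> i) \<and>
      (\<Sum>i=1..n. f (T i) (\<delta> i)) \<le> (\<Sum>i=1..n. f (T i) (\<gamma> (T i))) \<and>
      (\<Sum>i=1..n. \<delta> i * h i) \<le> (\<Sum>i=1..n. \<gamma> (T i) * h ((\<pi> \<circ> T) i))"
    by (rule sorted_assignment_dominates)
  then obtain \<delta> where \<delta>: "\<forall>i\<in>{1..n}. 0 \<le> \<delta> i"
      "(\<Sum>i=1..n. f (T i) (\<delta> i)) \<le> (\<Sum>i=1..n. f (T i) (\<gamma> (T i)))"
      "(\<Sum>i=1..n. \<delta> i * h i) \<le> (\<Sum>i=1..n. \<gamma> (T i) * h (\<pi> (T i)))"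
    by auto
  \<comment> \<open>The power that yields SNR \<open>\<delta> (R k)\<close> on channel
    \<open>R k\<close>.\<close>
  define p where "p k = \<delta> (R k) * h (R k)" for k
  have "(\<Sum>k=1..n. p k) = (\<Sum>i=1..n. \<delta> i * h i)"
    unfolding p_def by (rule sum.reindex_bij_betw[OF R])
  also note \<delta>(3)
  also have "(\<Sum>i=1..n. \<gamma> (T i) * h (\<pi> (T i))) = (\<Sum>k=1..n. \<gamma> k * h (\<pi> k))"
    by (rule sum.reindex_bij_betw[OF T])
  also have "\<dots> = (\<Sum>k=1..n. q k)"
  proof (intro sum.cong refl)
    fix k assume "k \<in> {1..n}"
    then show "\<gamma> k * h (\<pi> k) = q k"
      using s[OF \<pi>in] N by (force simp: \<gamma>_def h_def)
  qed
  finally have power: "(\<Sum>k=1..n. p k) \<le> (\<Sum>k=1..n. q k)" .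
  have "(\<Sum>k=1..n. f k (p k / N * (s (R k))\<^sup>2)) = (\<Sum>k=1..n. f (T (R k)) (\<delta> (R k)))"
  proof (intro sum.cong refl)
    fix k assume "k \<in> {1..n}"
    then show "f k (p k / N * (s (R k))\<^sup>2) = f (T (R k)) (\<delta> (R k))"
      using s[OF Rin, of k] N by (simp add: p_def h_def TR)
  qed
  also have "\<dots> = (\<Sum>i=1..n. f (T i) (\<delta> i))"
    by (rule sum.reindex_bij_betw[OF R])
  also note \<delta>(2)
  also have "(\<Sum>i=1..n. f (T i) (\<gamma> (T i))) = (\<Sum>k=1..n. f k (\<gamma> k))"
    by (rule sum.reindex_bij_betw[OF T])
  finally have loss: "(\<Sum>k=1..n. f k (p k / N * (s (R k))\<^sup>2)) \<le> (\<Sum>k=1..n. f k (\<gamma> k))" .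
  have "\<forall>k\<in>{1..n}. 0 \<le> p k"
    using \<delta>(1) Rin N by (simp add: p_def h_def)
  with power loss show ?thesis
    unfolding \<gamma>_def by blast
qed

section \<open>Compactness and continuity for the existence of a minimum\<close>

text \<open>Tychonoff's theorem, once for each argument. The bound covers all indices, since a free
  coordinate would range over the whole real line.\<close>

lemma compact_power_box:
  fixes P :: real
  shows "compact {p :: nat \<Rightarrow> nat \<Rightarrow> real. \<forall>j k. p j k \<in> {0..P}}"
proof -
  have "compactin (product_topology (\<lambda>_. euclidean) UNIV) (\<Pi>\<^sub>E k\<in>(UNIV::nat set). {0..P})"
    by (subst compactin_PiE) simp
  then have "compact (\<Pi>\<^sub>E k\<in>(UNIV::nat set). {0..P})"
    by (simp add: euclidean_product_topology)
  then have "compactin (product_topology (\<lambda>_. euclidean) UNIV)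
      (\<Pi>\<^sub>E j\<in>(UNIV::nat set). \<Pi>\<^sub>E k\<in>(UNIV::nat set). {0..P})"
    by (subst compactin_PiE) simp
  then have "compact (\<Pi>\<^sub>E j\<in>(UNIV::nat set). \<Pi>\<^sub>E k\<in>(UNIV::nat set). {0..P})"
    by (simp add: euclidean_product_topology)
  then show ?thesis
    by (rule back_subst[of compact]) (auto simp: PiE_iff)
qed

lemma continuous_on_entry [continuous_intros]:
  "continuous_on S (\<lambda>p :: nat \<Rightarrow> nat \<Rightarrow> real. p j k)"
  using continuous_on_product_then_coordinatewise[OF
    continuous_on_product_then_coordinatewise[OF continuous_on_id]] .

text \<open>A positive \<open>c j k\<close> keeps the denominator away from 0, and a positive
  exponent makes the power function continuous at SNR 0 as well.\<close>

lemma continuous_on_recon_loss: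
  assumes "0 < c j k" and "0 < e j k"
  shows "continuous_on {0..} (recon_loss b c d e j k)"
proof -
  have "c j k + x powr e j k \<noteq> 0" for x
    using assms(1) by (smt (verit) powr_ge_zero)
  then show ?thesis
    unfolding recon_loss_def using assms(2)
    by (intro continuous_intros continuous_on_powr') auto
qed

section \<open>Optimality of the allocation by rank\<close>

theorem theorem1:
  fixes J :: nat and K :: "nat \<Rightarrow> nat" and P \<sigma>n :: real
    and \<sigma> b c d e :: "nat \<Rightarrow> nat \<Rightarrow> real"
    and I :: "nat \<Rightarrow> nat \<Rightarrow> nat"
  assumes "\<And>j. j \<in> {1..J} \<Longrightarrow> K j \<ge> 1"
    and "P > 0" and "\<sigma>n\<^sup>2 > 0"
    and "\<And>j k. j \<in> {1..J} \<Longrightarrow> k \<in> {1..K j} \<Longrightarrow> \<sigma> j k > 0"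
    and "\<And>j k k'. j \<in> {1..J} \<Longrightarrow> k \<in> {1..K j} \<Longrightarrow> k' \<in> {1..K j} \<Longrightarrow> k \<le> k'
           \<Longrightarrow> \<sigma> j k \<ge> \<sigma> j k'"
    and "\<And>j k. j \<in> {1..J} \<Longrightarrow> k \<in> {1..K j}
           \<Longrightarrow> b j k > 0 \<and> c j k > 0 \<and> d j k > 0 \<and> e j k > 0"
    and "\<And>j. j \<in> {1..J} \<Longrightarrow> bij_betw (I j) {1..K j} {1..K j}"
    and "\<And>j k\<^sub>1 k\<^sub>2 \<gamma> \<gamma>'. j \<in> {1..J} \<Longrightarrow> k\<^sub>1 \<in> {1..K j} \<Longrightarrow> k\<^sub>2 \<in> {1..K j}
           \<Longrightarrow> I j k\<^sub>1 < I j k\<^sub>2 \<Longrightarrow> 0 \<le> \<gamma> \<Longrightarrow> \<gamma> < \<gamma>'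
           \<Longrightarrow> recon_loss b c d e j k\<^sub>1 \<gamma> - recon_loss b c d e j k\<^sub>1 \<gamma>'
              > recon_loss b c d e j k\<^sub>2 \<gamma> - recon_loss b c d e j k\<^sub>2 \<gamma>'"
  shows "\<exists>p. is_arg_min (total_loss J K \<sigma> \<sigma>n (recon_loss b c d e)) (feasible J K P)
               (p, rank_allocation I)"
proof -
  note P = assms(2) and N = assms(3) and \<sigma> = assms(4) and anti = assms(5)
    and par = assms(6) and bij = assms(7) and imp = assms(8)
  let ?f = "recon_loss b c d e"
  let ?L = "total_loss J K \<sigma> \<sigma>n ?f"
  let ?S = "\<lambda>p. \<Sum>j=1..J. \<Sum>k=1..K j. p j k"
  \<comment> \<open>The box makes the budget set compact; the best powers for the allocation by rank
    are sought in \<open>C\<close>.\<close>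
  define C where "C = {p :: nat \<Rightarrow> nat \<Rightarrow> real. \<forall>j k. p j k \<in> {0..P}} \<inter> {p. ?S p \<le> P}"
  have "closed {p. ?S p \<le> P}"
    by (intro closed_Collect_le continuous_intros)
  then have "compact C"
    unfolding C_def using compact_power_box by (rule compact_Int_closed[rotated])
  moreover have "(\<lambda>_ _. 0) \<in> C"
    using P by (simp add: C_def)
  moreover have "continuous_on C (\<lambda>p. ?L (p, rank_allocation I))"
  proof -
    have "continuous_on C (\<lambda>p. ?f j k (received_snr K \<sigma> \<sigma>n p (rank_allocation I) j k))"
      if jk: "j \<in> {1..J}" "k \<in> {1..K j}" for j k
    proof -
      have "continuous_on C (\<lambda>p. ?f j k (p j k / \<sigma>n\<^sup>2 * (\<sigma> j (I j k))\<^sup>2))"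
        using par[OF jk] N
        by (intro continuous_on_compose2[OF continuous_on_recon_loss] continuous_intros)
          (auto simp: C_def)
      then show ?thesis
        using bij_betwE[OF bij[OF jk(1)]] jk(2) by (simp add: received_snr_rank_allocation)
    qed
    then show ?thesis
      unfolding total_loss_def prod.case by (intro continuous_intros) auto
  qed
  ultimately obtain p where p: "p \<in> C"
      "\<And>p'. p' \<in> C \<Longrightarrow> ?L (p, rank_allocation I) \<le> ?L (p', rank_allocation I)"
    using continuous_attains_inf[of C "\<lambda>p. ?L (p, rank_allocation I)"] by blast
  have "?L (p, rank_allocation I) \<le> ?L (q, A)" if feas: "feasible J K P (q, A)" for q A
  proof -
    \<comment> \<open>All requirements on the replacement powers of user \<open>j\<close> in one
      predicate, so that a single choice over the users produces \<open>p0\<close>.\<close>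
    define Q where "Q j p \<longleftrightarrow> (\<forall>k\<in>{1..K j}. 0 \<le> p k) \<and>
        (\<Sum>k=1..K j. p k) \<le> (\<Sum>k=1..K j. q j k) \<and>
        (\<Sum>k=1..K j. ?f j k (p k / \<sigma>n\<^sup>2 * (\<sigma> j (I j k))\<^sup>2))
          \<le> (\<Sum>k=1..K j. ?f j k (received_snr K \<sigma> \<sigma>n q A j k))" for j p
    have "\<forall>j\<in>{1..J}. \<exists>p. Q j p"
    proof
      fix j assume j: "j \<in> {1..J}"
      obtain \<pi> where \<pi>: "bij_betw \<pi> {1..K j} {1..K j}"
        "\<And>k k'. k \<in> {1..K j} \<Longrightarrow> k' \<in> {1..K j} \<Longrightarrow> A j k k' = (if k = \<pi> k' then 1 else 0)"
        using permutation_matrix_obtains[of "K j" "A j"] feas j unfolding feasible_def by auto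
      have "received_snr K \<sigma> \<sigma>n q A j k = q j k / \<sigma>n\<^sup>2 * (\<sigma> j (\<pi> k))\<^sup>2" if "k \<in> {1..K j}" for k
        using that bij_betwE[OF \<pi>(1)] \<pi>(2) by (intro received_snr_of_map) auto
      moreover have "\<exists>p. (\<forall>k\<in>{1..K j}. 0 \<le> p k) \<and> (\<Sum>k=1..K j. p k) \<le> (\<Sum>k=1..K j. q j k) \<and>
        (\<Sum>k=1..K j. ?f j k (p k / \<sigma>n\<^sup>2 * (\<sigma> j (I j k))\<^sup>2))
          \<le> (\<Sum>k=1..K j. ?f j k (q j k / \<sigma>n\<^sup>2 * (\<sigma> j (\<pi> k))\<^sup>2))"
      proof (rule user_power_exchange[OF N \<sigma>[OF j] anti[OF j] bij[OF j] \<pi>(1)])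
        show "0 \<le> q j k" if "k \<in> {1..K j}" for k
          using feas j that by (auto simp: feasible_def)
        show "?f j k y + ?f j k' x \<le> ?f j k x + ?f j k' y"
          if "k \<in> {1..K j}" "k' \<in> {1..K j}" "I j k < I j k'" "0 \<le> x" "x < y" for k k' x y
          using imp[OF j that] by simp
      qed
      ultimately show "\<exists>p. Q j p"
        unfolding Q_def by simp
    qed
    then obtain p0 where "\<And>j. j \<in> {1..J} \<Longrightarrow> Q j (p0 j)"
      by metis
    then have p0: "\<And>j k. j \<in> {1..J} \<Longrightarrow> k \<in> {1..K j} \<Longrightarrow> 0 \<le> p0 j k"
        "\<And>j. j \<in> {1..J} \<Longrightarrow> (\<Sum>k=1..K j. p0 j k) \<le> (\<Sum>k=1..K j. q j k)"
        "\<And>j. j \<in> {1..J} \<Longrightarrow> (\<Sum>k=1..K j. ?f j k (p0 j k / \<sigma>n\<^sup>2 * (\<sigma> j (I j k))\<^sup>2))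
          \<le> (\<Sum>k=1..K j. ?f j k (received_snr K \<sigma> \<sigma>n q A j k))"
      unfolding Q_def by blast+
    \<comment> \<open>\<open>p0\<close> is arbitrary outside the index range, whereas
      \<open>C\<close> bounds every coordinate. Setting the others to 0 changes neither the total
      power nor the loss.\<close>
    define p' where "p' j k = (if j \<in> {1..J} \<and> k \<in> {1..K j} then p0 j k else 0)" for j k
    have p'_nonneg: "0 \<le> p' j k" for j k
      using p0(1) by (simp add: p'_def)
    have "?S p' = ?S p0"
      by (intro sum.cong) (auto simp: p'_def)
    also have "\<dots> \<le> ?S q"
      using p0(2) by (rule sum_mono)
    also have "\<dots> \<le> P"
      using feas by (simp add: feasible_def)
    finally have S: "?S p' \<le> P" .
    \<comment> \<open>All powers being nonnegative, each one is at most the total, hence at most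
      \<open>P\<close>.\<close>
    have "p' j k \<le> P" for j k
    proof (cases "j \<in> {1..J} \<and> k \<in> {1..K j}")
      case True
      then have "p' j k \<le> (\<Sum>k=1..K j. p' j k)"
        using p'_nonneg by (intro member_le_sum) auto
      also have "\<dots> \<le> ?S p'"
        using True p'_nonneg by (intro member_le_sum[of j _ "\<lambda>j. \<Sum>k=1..K j. p' j k"] sum_nonneg) auto
      finally show ?thesis
        using S by simp
    qed (use P in \<open>auto simp: p'_def\<close>)
    then have "p' \<in> C"
      using S p'_nonneg by (simp add: C_def)
    then have "?L (p, rank_allocation I) \<le> ?L (p', rank_allocation I)"
      by (rule p(2))
    also have "\<dots> \<le> ?L (q, A)"
      unfolding total_loss_def prod.case
    proof (rule sum_mono, rule mult_left_mono)
      fix j assume j: "j \<in> {1..J}"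
      have "(\<Sum>k=1..K j. ?f j k (received_snr K \<sigma> \<sigma>n p' (rank_allocation I) j k))
          = (\<Sum>k=1..K j. ?f j k (p0 j k / \<sigma>n\<^sup>2 * (\<sigma> j (I j k))\<^sup>2))"
        using bij_betwE[OF bij[OF j]] j
        by (intro sum.cong) (auto simp: received_snr_rank_allocation p'_def)
      then show "(\<Sum>k=1..K j. ?f j k (received_snr K \<sigma> \<sigma>n p' (rank_allocation I) j k))
          \<le> (\<Sum>k=1..K j. ?f j k (received_snr K \<sigma> \<sigma>n q A j k))"
        using p0(3)[OF j] by simp
    qed simp
    finally show ?thesis .
  qed
  moreover have "feasible J K P (p, rank_allocation I)"
    using p(1) by (intro feasible_rank_allocation bij) (auto simp: C_def)
  ultimately show ?thesis
    unfolding is_arg_min_def by (intro exI[of _ p]) (auto simp: not_less)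
qed

end
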